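(* Let $T:\mathbf{M}_2(\mathbb{R})\to\mathbf{M}_2(\mathbb{R})$ be a real linear map. (a) $T$ preserves TEA pairs if and only if $T$ has one of the following forms. (a.1) There are real orthogonal matrices $F_1,F_2\in\mathbf{U}_2(\mathbb{R})$ with $F_1^{\mathrm{t}}F_2=\begin{pmatrix}0&1\\-1&0\end{pmatrix}$ and $Z_1,Z_2\in\mathbf{M}_2(\mathbb{R})$ such that $T$ has the form $X\mapsto \operatorname{trace}(F_1X)Z_1+\operatorname{trace}(F_2X)Z_2$. (a.2) There are real orthogonal matrices $U_1,U_2,V_1,V_2\in\mathbf{U}_2(\mathbb{R})$ such that the matrix representation, with respect to the basis $\mathbf{R}$, of the linear transformation $\tilde T$ defined by $A\mapsto U_1T(U_2AV_2)V_1$ has the diagonal form $$[\tilde T]_{\mathbf{R}}=\begin{pmatrix}d_0&0&0&0\\0&d_1&0&0\\0&0&d_2&0\\0&0&0&d_3\end{pmatrix}\in\mathbf{M}_4(\mathbb{R}).$$ (b) $T$ preserves parallel pairs if and only if $T$ has the form in (a.1), or the form in (a.2), or the form $A\mapsto\operatorname{trace}(FA)Z$ for some $F,Z\in\mathbf{M}_2(\mathbb{R})$.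
   Context: $\mathbf{M}_k(\mathbb{R})$ is the space of $k\times k$ real matrices; $\mathbf{M}_2(\mathbb{R})$ carries the spectral (operator) norm $\|A\|=\max\{\|Ax\|: x\in\mathbb{R}^2,\|x\|=1\}$ (Euclidean norms on $\mathbb{R}^2$). $\mathbf{U}_2(\mathbb{R})$ is the group of $2\times2$ real orthogonal matrices. $A^{\mathrm{t}}$ is the transpose of $A$. Matrices $A,B\in\mathbf{M}_2(\mathbb{R})$ are parallel (form a parallel pair) if $\|A+\mu B\|=\|A\|+\|B\|$ for some $\mu\in\{1,-1\}$; they form a triangle equality attaining (TEA) pair if $\|A+B\|=\|A\|+\|B\|$. A linear map $T$ preserves parallel pairs (resp. TEA pairs) if $T(A),T(B)$ are parallel (resp. form a TEA pair) whenever $A,B$ are parallel (resp. form a TEA pair). Let $I_2=\begin{pmatrix}1&0\\0&1\end{pmatrix}$, $\mathcal{R}_1=\begin{pmatrix}1&0\\0&-1\end{pmatrix}$, $\mathcal{R}_2=\begin{pmatrix}0&1\\1&0\end{pmatrix}$, $\mathcal{R}_3=\begin{pmatrix}0&1\\-1&0\end{pmatrix}$. Then $\mathbf{R}=\{I_2/\sqrt2,\mathcal{R}_1/\sqrt2,\mathcal{R}_2/\sqrt2,\mathcal{R}_3/\sqrt2\}$ (in this order) is an orthonormal basis of $\mathbf{M}_2(\mathbb{R})$ with respect to $\langle A,B\rangle=\operatorname{trace}(B^{\mathrm{t}}A)$. In a matrix representation, the columns are the coordinate vectors of the images of the basis elements. *)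

theory Defs
  imports "HOL-Analysis.Analysis"
begin

text \<open>The library norm on \<^typ>\<open>real^2^2\<close> is the Frobenius norm, so the spectral norm needs a
  constant of its own.\<close>

definition spectral_norm :: "real^2^2 \<Rightarrow> real" where
  "spectral_norm A = onorm (\<lambda>x. A *v x)"

lemma spectral_norm_Max:
  "spectral_norm A \<in> {norm (A *v x) | x. norm x = 1}"
  "norm x = 1 \<Longrightarrow> norm (A *v x) \<le> spectral_norm A"
proof -
  have bl: "bounded_linear (\<lambda>x. A *v x)"
    by (simp add: matrix_vector_mul_bounded_linear)
  show le: "norm (A *v x) \<le> spectral_norm A" if "norm x = 1" for x
    using onorm[OF bl, of x] that by (simp add: spectral_norm_def)
  have "axis 1 1 \<in> sphere (0 :: real^2) 1"
    by simp
  then have "sphere (0 :: real^2) 1 \<noteq> {}"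
    by blast
  moreover have "continuous_on (sphere 0 1) (\<lambda>x. norm (A *v x))"
    by (intro continuous_intros linear_continuous_on bl)
  ultimately obtain u where u: "u \<in> sphere 0 1"
      "\<And>x. x \<in> sphere 0 1 \<Longrightarrow> norm (A *v x) \<le> norm (A *v u)"
    using continuous_attains_sup[of "sphere (0 :: real^2) 1" "\<lambda>x. norm (A *v x)"] by auto
  have "norm (A *v x) \<le> norm (A *v u) * norm x" for x
  proof (cases "x = 0")
    case False
    then have "norm (A *v (x /\<^sub>R norm x)) \<le> norm (A *v u)"
      using u(2)[of "x /\<^sub>R norm x"] by simp
    then show ?thesis
      using False by (simp add: linear_scale[OF matrix_vector_mul_linear] field_simps)
  qed simp
  then have "spectral_norm A \<le> norm (A *v u)"
    unfolding spectral_norm_def by (intro onorm_le)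
  with le[of u] u(1) show "spectral_norm A \<in> {norm (A *v x) | x. norm x = 1}"
    by force
qed

definition TEA_pair :: "real^2^2 \<Rightarrow> real^2^2 \<Rightarrow> bool" where
  "TEA_pair A B \<longleftrightarrow> spectral_norm (A + B) = spectral_norm A + spectral_norm B"

definition parallel_pair :: "real^2^2 \<Rightarrow> real^2^2 \<Rightarrow> bool" where
  "parallel_pair A B \<longleftrightarrow>
     (\<exists>\<mu>\<in>{1, -1}. spectral_norm (A + \<mu> *\<^sub>R B) = spectral_norm A + spectral_norm B)"

definition preserves_TEA_pairs :: "(real^2^2 \<Rightarrow> real^2^2) \<Rightarrow> bool" where
  "preserves_TEA_pairs T \<longleftrightarrow> (\<forall>A B. TEA_pair A B \<longrightarrow> TEA_pair (T A) (T B))"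

definition preserves_parallel_pairs :: "(real^2^2 \<Rightarrow> real^2^2) \<Rightarrow> bool" where
  "preserves_parallel_pairs T \<longleftrightarrow> (\<forall>A B. parallel_pair A B \<longrightarrow> parallel_pair (T A) (T B))"

definition mat_R1 :: "real^2^2" where
  "mat_R1 = vector [vector [1, 0], vector [0, -1]]"

definition mat_R2 :: "real^2^2" where
  "mat_R2 = vector [vector [0, 1], vector [1, 0]]"

definition mat_R3 :: "real^2^2" where
  "mat_R3 = vector [vector [0, 1], vector [-1, 0]]"

text \<open>An ordered basis is a vector of matrices; the index type \<^typ>\<open>4\<close> is enumerated as
  1, 2, 3, 4, so the identity matrix has index 1.\<close>

definition basis_R :: "(real^2^2)^4" where
  "basis_R = vector [mat 1 /\<^sub>R sqrt 2, mat_R1 /\<^sub>R sqrt 2, mat_R2 /\<^sub>R sqrt 2, mat_R3 /\<^sub>R sqrt 2]"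

text \<open>Column \<open>j\<close> holds the coordinates of \<open>T (B $ j)\<close>. The library's \<^const>\<open>representation\<close> is
  meaningful only for an independent set; \<open>basis_R_basis\<close> below ensures this.\<close>

definition matrix_rep :: "(real^2^2)^4 \<Rightarrow> (real^2^2 \<Rightarrow> real^2^2) \<Rightarrow> real^4^4" where
  "matrix_rep B T = (\<chi> i j. representation (range (($) B)) (T (B $ j)) (B $ i))"

definition two_trace_form :: "(real^2^2 \<Rightarrow> real^2^2) \<Rightarrow> bool" where
  "two_trace_form T \<longleftrightarrow>
     (\<exists>F1 F2 Z1 Z2. orthogonal_matrix F1 \<and> orthogonal_matrix F2 \<and>
        transpose F1 ** F2 = mat_R3 \<and>
        (\<forall>X. T X = trace (F1 ** X) *\<^sub>R Z1 + trace (F2 ** X) *\<^sub>R Z2))"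

definition diagonal_form :: "(real^2^2 \<Rightarrow> real^2^2) \<Rightarrow> bool" where
  "diagonal_form T \<longleftrightarrow>
     (\<exists>U1 U2 V1 V2. orthogonal_matrix U1 \<and> orthogonal_matrix U2 \<and>
        orthogonal_matrix V1 \<and> orthogonal_matrix V2 \<and>
        (\<exists>d0 d1 d2 d3. matrix_rep basis_R (\<lambda>A. U1 ** T (U2 ** A ** V2) ** V1) =
           vector [vector [d0, 0, 0, 0],
                   vector [0, d1, 0, 0],
                   vector [0, 0, d2, 0],
                   vector [0, 0, 0, d3]]))"

definition one_trace_form :: "(real^2^2 \<Rightarrow> real^2^2) \<Rightarrow> bool" where
  "one_trace_form T \<longleftrightarrow> (\<exists>F Z. \<forall>A. T A = trace (F ** A) *\<^sub>R Z)"

lemma vector_4_nth [simp]: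
  "(vector [a, b, c, d] :: 'a::zero^4) $ 1 = a"
  "(vector [a, b, c, d] :: 'a::zero^4) $ 2 = b"
  "(vector [a, b, c, d] :: 'a::zero^4) $ 3 = c"
  "(vector [a, b, c, d] :: 'a::zero^4) $ 4 = d"
  unfolding vector_def by simp_all

lemma trace_inner: "trace (transpose B ** A) = A \<bullet> (B :: real^2^2)"
  by (simp add: trace_def matrix_matrix_mult_def transpose_def inner_vec_def sum_2 algebra_simps)

lemma basis_R_orthonormal:
  "trace (transpose (basis_R $ i) ** (basis_R $ j)) = (if i = j then 1 else 0)"
proof -
  have "\<forall>i j. basis_R $ j \<bullet> basis_R $ i = (if i = j then 1 else 0)"
    unfolding forall_4
    by (simp add: basis_R_def mat_R1_def mat_R2_def mat_R3_def mat_def inner_vec_def sum_2 power_inverse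
        flip: power2_eq_square)
  then show ?thesis
    by (simp add: trace_inner)
qed

lemma basis_R_basis:
  "inj (($) basis_R)" "independent (range (($) basis_R))" "span (range (($) basis_R)) = UNIV"
proof -
  have inner: "basis_R $ j \<bullet> basis_R $ i = (if i = j then 1 else 0)" for i j
    using basis_R_orthonormal[of i j] by (simp add: trace_inner)
  show inj: "inj (($) basis_R)"
    by (rule injI) (metis inner zero_neq_one)
  show ind: "independent (range (($) basis_R))"
  proof (rule pairwise_orthogonal_independent)
    show "pairwise orthogonal (range (($) basis_R))"
      unfolding pairwise_def orthogonal_def using inner by auto
    show "0 \<notin> range (($) basis_R)"
      by (metis imageE inner inner_zero_left zero_neq_one)
  qed
  have "card (range (($) basis_R)) = DIM(real^2^2)"
    using inj by (simp add: card_image)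
  then show "span (range (($) basis_R)) = UNIV"
    using ind card_ge_dim_independent[of "range (($) basis_R)" UNIV] by auto
qed

lemma matrix_rep_basis_R:
  "T (basis_R $ j) = (\<Sum>i\<in>UNIV. matrix_rep basis_R T $ i $ j *\<^sub>R basis_R $ i)"
proof -
  let ?S = "range (($) basis_R)"
  have "T (basis_R $ j) = (\<Sum>b\<in>?S. representation ?S (T (basis_R $ j)) b *\<^sub>R b)"
    using basis_R_basis by (intro real_vector.sum_representation_eq[symmetric]) auto
  then show ?thesis
    by (simp add: sum.reindex[OF basis_R_basis(1)] matrix_rep_def)
qed

end

theory Submission
  imports Defs
begin

text \<open>
  Identify the plane with the complex numbers. Every real matrix \<open>A\<close> acts as
  \<open>z \<mapsto> p z + q cnj z\<close> for unique complex \<open>p\<close> and \<open>q\<close>, its conformal and its anticonformal part, and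
  the spectral norm of \<open>A\<close> is \<open>\<bar>p\<bar> + \<bar>q\<bar>\<close> (\<open>spectral_norm_eq\<close>). So the matrix space is the
  \<open>\<ell>\<^sup>1\<close>-sum of two Euclidean planes, and two matrices attain the triangle equality iff their
  conformal parts lie on a common ray from the origin and so do their anticonformal parts
  (\<open>TEA_pair_iff_codirectional\<close>). Parallel pairs are the same up to the sign of one matrix.

  A linear map \<open>T\<close> is then a \<open>2 \<times> 2\<close> array of real-linear maps of the complex plane. A purely
  conformal and a purely anticonformal matrix form a TEA pair whatever their signs. If \<open>T\<close> preserves
  TEA pairs, then the conformal parts of the two images are codirectional and remain so when one of
  them is negated, so one of them vanishes, and likewise for the anticonformal parts. Hence each row of the array has a zero entry: \<open>T\<close> is
  \<open>decoupled\<close>. The converse holds because linear maps preserve codirectional pairs.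
  The decoupled arrays are of four types. If a column is zero, \<open>T\<close> depends on only one of the two
  parts of its argument, whose real coordinates are traces against two orthogonal matrices; this is
  \<open>two_trace_form\<close>. A diagonal array becomes diagonal in the basis by a singular value decomposition
  of its two blocks: multiplying a matrix by rotations from the left and from the right rotates its
  two parts by arbitrary independent angles (\<open>rotate_parts_independently\<close>). An antidiagonal array
  becomes diagonal after a reflection, which swaps the two parts.

  If \<open>T\<close> preserves parallel pairs and is not decoupled, then after a reflection both entries of the
  conformal row are nonzero. Let \<open>A\<close> and \<open>B\<close> be images of a conformal and an anticonformal matrix,
  with nonzero conformal parts. These parts are proportional because \<open>A\<close> and \<open>B\<close> are parallel.
  Moreover \<open>A + t B\<close> is parallel to \<open>A\<close> and to \<open>B\<close> for every real \<open>t\<close>. When \<open>t\<close> passes the value at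
  which the conformal part of \<open>A + t B\<close> vanishes, that part reverses its direction. The anticonformal
  part then vanishes at the same value: otherwise it would keep its direction, and \<open>A + t B\<close> would
  fail to be parallel to \<open>A\<close> or to \<open>B\<close> on one side of that value. So \<open>A\<close> and \<open>B\<close> are
  proportional (\<open>parallel_preserver_images_proportional\<close>), and \<open>T\<close> has rank one.
\<close>

section \<open>Conformal and anticonformal parts\<close>

definition conformal_part :: "real^2^2 \<Rightarrow> complex" where
  "conformal_part A = Complex ((A$1$1 + A$2$2) / 2) ((A$2$1 - A$1$2) / 2)"

definition anticonformal_part :: "real^2^2 \<Rightarrow> complex" where
  "anticonformal_part A = Complex ((A$1$1 - A$2$2) / 2) ((A$2$1 + A$1$2) / 2)"

definition matrix_of_parts :: "complex \<Rightarrow> complex \<Rightarrow> real^2^2" where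
  "matrix_of_parts p q =
     vector [vector [Re p + Re q, Im q - Im p], vector [Im p + Im q, Re p - Re q]]"

definition complex_of_vec :: "real^2 \<Rightarrow> complex" where
  "complex_of_vec x = Complex (x$1) (x$2)"

lemma parts_matrix_of_parts [simp]:
  "conformal_part (matrix_of_parts p q) = p"
  "anticonformal_part (matrix_of_parts p q) = q"
  by (simp_all add: conformal_part_def anticonformal_part_def matrix_of_parts_def complex_eq_iff)

lemma matrix_eq_iff_parts:
  "A = B \<longleftrightarrow> conformal_part A = conformal_part B \<and> anticonformal_part A = anticonformal_part B"
  by (auto simp: conformal_part_def anticonformal_part_def vec_eq_iff forall_2)

lemma linear_parts: "linear conformal_part" "linear anticonformal_part"
  by (rule linearI; simp add: conformal_part_def anticonformal_part_def complex_eq_iff field_simps)+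

lemmas parts_add [simp] = linear_add[OF linear_parts(1)] linear_add[OF linear_parts(2)]
lemmas parts_minus [simp] = linear_neg[OF linear_parts(1)] linear_neg[OF linear_parts(2)]
lemmas parts_diff [simp] = linear_diff[OF linear_parts(1)] linear_diff[OF linear_parts(2)]
lemmas parts_scaleR [simp] = linear_scale[OF linear_parts(1)] linear_scale[OF linear_parts(2)]
lemmas parts_zero [simp] = linear_0[OF linear_parts(1)] linear_0[OF linear_parts(2)]

lemma linear_matrix_of_parts:
  "linear (\<lambda>p. matrix_of_parts p 0)" "linear (\<lambda>q. matrix_of_parts 0 q)"
  by (rule linearI; simp add: matrix_eq_iff_parts)+

lemma matrix_split: "A = matrix_of_parts (conformal_part A) 0 + matrix_of_parts 0 (anticonformal_part A)"
  by (simp add: matrix_eq_iff_parts)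

lemma parts_mult [simp]:
  "conformal_part (A ** B) =
     conformal_part A * conformal_part B + anticonformal_part A * cnj (anticonformal_part B)"
  "anticonformal_part (A ** B) =
     conformal_part A * anticonformal_part B + anticonformal_part A * cnj (conformal_part B)"
  by (simp_all add: conformal_part_def anticonformal_part_def matrix_matrix_mult_def sum_2
      complex_eq_iff field_simps)

lemma linear_mult_both:
  fixes T :: "'a::real_vector \<Rightarrow> real^2^2" and U V :: "real^2^2"
  assumes "linear T"
  shows "linear (\<lambda>X. U ** T X ** V)"
  by (rule linearI)
    (simp_all add: linear_add[OF assms] linear_scale[OF assms] matrix_eq_iff_parts algebra_simps)

lemma parts_transpose [simp]:
  "conformal_part (transpose A) = cnj (conformal_part A)"
  "anticonformal_part (transpose A) = anticonformal_part A"
  by (simp_all add: conformal_part_def anticonformal_part_def transpose_def complex_eq_iff field_simps)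

lemma parts_constants [simp]:
  "conformal_part (mat 1) = 1" "anticonformal_part (mat 1) = 0"
  "conformal_part mat_R1 = 0" "anticonformal_part mat_R1 = 1"
  "conformal_part mat_R2 = 0" "anticonformal_part mat_R2 = \<i>"
  "conformal_part mat_R3 = - \<i>" "anticonformal_part mat_R3 = 0"
  by (simp_all add: conformal_part_def anticonformal_part_def mat_R1_def mat_R2_def mat_R3_def
      mat_def complex_eq_iff)

lemma trace_eq_Re_conformal_part: "trace A = 2 * Re (conformal_part A)"
  by (simp add: trace_def conformal_part_def sum_2)

lemma complex_of_vec_mult:
  "complex_of_vec (A *v x) =
     conformal_part A * complex_of_vec x + anticonformal_part A * cnj (complex_of_vec x)"
  by (simp add: complex_of_vec_def conformal_part_def anticonformal_part_def
      matrix_vector_mult_def sum_2 complex_eq_iff field_simps)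

lemma norm_complex_of_vec: "cmod (complex_of_vec x) = norm x"
  by (simp add: complex_of_vec_def norm_vec_def L2_set_def sum_2 cmod_def)

text \<open>
  The equation \<open>A\<^sup>T A = I\<close> reads \<open>\<bar>p\<bar>\<^sup>2 + \<bar>q\<bar>\<^sup>2 = 1\<close> and \<open>2 q cnj p = 0\<close> in terms of the parts.
  The two alternatives are the rotations and the reflections.
\<close>

lemma orthogonal_matrix_iff_parts:
  "orthogonal_matrix A \<longleftrightarrow>
     cmod (conformal_part A) = 1 \<and> anticonformal_part A = 0 \<or>
     conformal_part A = 0 \<and> cmod (anticonformal_part A) = 1"
proof -
  let ?p = "conformal_part A" and ?q = "anticonformal_part A"
  have "orthogonal_matrix A \<longleftrightarrow> cnj ?p * ?p + ?q * cnj ?q = 1 \<and> cnj ?p * ?q + ?q * cnj ?p = 0"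
    by (simp add: orthogonal_matrix matrix_eq_iff_parts)
  also have "cnj ?p * ?p + ?q * cnj ?q = of_real ((cmod ?p)\<^sup>2 + (cmod ?q)\<^sup>2)"
    by (simp only: of_real_add complex_norm_square mult.commute)
  also have "cnj ?p * ?q + ?q * cnj ?p = 0 \<longleftrightarrow> ?p = 0 \<or> ?q = 0"
    by (auto simp: mult.commute simp flip: mult_2)
  finally have "orthogonal_matrix A \<longleftrightarrow>
      (cmod ?p)\<^sup>2 + (cmod ?q)\<^sup>2 = 1 \<and> (?p = 0 \<or> ?q = 0)"
    by (simp only: of_real_eq_1_iff)
  moreover have "r\<^sup>2 = 1 \<longleftrightarrow> r = 1" if "r \<ge> 0" for r :: real
    using that by (simp add: power2_eq_1_iff)
  ultimately show ?thesis
    by auto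
qed

section \<open>The spectral norm\<close>

text \<open>
  Multiplying by \<open>u\<close> adds its argument to that of \<open>p\<close>, multiplying by \<open>cnj u\<close> subtracts it from that
  of \<open>q\<close>; half the difference of the arguments brings both products to the same direction. Besides
  the norm formula, this yields singular value decompositions and independent rotations of the parts.
\<close>

lemma exists_aligning_rotation:
  obtains u w where "cmod u = 1" "cmod w = 1" "p * u = of_real (cmod p) * w"
    "q * cnj u = of_real (cmod q) * w"
proof -
  obtain a where a: "p = of_real (cmod p) * cis a"
    using rcis_cmod_Arg[of p] by (metis rcis_def)
  obtain b where b: "q = of_real (cmod q) * cis b"
    using rcis_cmod_Arg[of q] by (metis rcis_def)
  let ?u = "cis ((b - a) / 2)" and ?w = "cis ((a + b) / 2)"
  have "p * ?u = of_real (cmod p) * ?w"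
    by (subst a) (simp add: cis_mult mult.assoc field_simps)
  moreover have "q * cnj ?u = of_real (cmod q) * ?w"
    by (subst b) (simp add: cis_cnj cis_mult mult.assoc field_simps)
  ultimately show thesis
    using that[of ?u ?w] by simp
qed

text \<open>
  The upper bound is the triangle inequality for \<open>p z + q cnj z\<close>; it is attained at a unit vector \<open>z\<close>
  that makes the two summands codirectional.
\<close>

lemma spectral_norm_eq:
  "spectral_norm A = cmod (conformal_part A) + cmod (anticonformal_part A)"
proof (rule antisym)
  let ?p = "conformal_part A" and ?q = "anticonformal_part A"
  have "norm (A *v x) \<le> (cmod ?p + cmod ?q) * norm x" for x
    using norm_triangle_ineq[of "?p * complex_of_vec x" "?q * cnj (complex_of_vec x)"]
    by (simp add: complex_of_vec_mult norm_mult algebra_simps flip: norm_complex_of_vec)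
  then show "spectral_norm A \<le> cmod ?p + cmod ?q"
    unfolding spectral_norm_def by (intro onorm_le)
  obtain u w where u: "cmod u = 1" "cmod w = 1" "?p * u = of_real (cmod ?p) * w"
    "?q * cnj u = of_real (cmod ?q) * w"
    by (rule exists_aligning_rotation)
  define x :: "real^2" where "x = vector [Re u, Im u]"
  have x: "complex_of_vec x = u"
    by (simp add: x_def complex_of_vec_def)
  then have "norm x = 1"
    using u(1) by (simp flip: norm_complex_of_vec)
  moreover have "complex_of_vec (A *v x) = of_real (cmod ?p + cmod ?q) * w"
    using u(3,4) by (simp add: complex_of_vec_mult x algebra_simps)
  then have "norm (A *v x) = cmod ?p + cmod ?q"
    using u(2) by (simp add: norm_mult abs_of_nonneg del: of_real_add flip: norm_complex_of_vec)
  ultimately show "cmod ?p + cmod ?q \<le> spectral_norm A"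
    using spectral_norm_Max(2)[of x A] by simp
qed

section \<open>TEA pairs and codirectional parts\<close>

definition codirectional :: "'a::real_normed_vector \<Rightarrow> 'a \<Rightarrow> bool" where
  "codirectional x y \<longleftrightarrow> norm (x + y) = norm x + norm y"

lemma codirectional_iff_scaleR:
  fixes x y :: "'a::real_inner"
  shows "codirectional x y \<longleftrightarrow> norm x *\<^sub>R y = norm y *\<^sub>R x"
  unfolding codirectional_def norm_triangle_eq by auto

lemma codirectional_zero [simp]: "codirectional x 0" "codirectional 0 x"
  by (simp_all add: codirectional_def)

lemma codirectional_scaleR:
  "c \<ge> 0 \<Longrightarrow> codirectional x (c *\<^sub>R x)"
  using norm_scaleR[of "1 + c" x] by (simp add: codirectional_def algebra_simps)

lemma codirectional_linear_image:
  fixes f :: "'a::real_inner \<Rightarrow> 'b::real_normed_vector"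
  assumes "linear f" "codirectional x y"
  shows "codirectional (f x) (f y)"
proof (cases "x = 0")
  case False
  then have "y = (norm y / norm x) *\<^sub>R x"
    using assms(2) by (simp add: codirectional_iff_scaleR divideR_right divide_inverse_commute
        flip: scaleR_scaleR)
  then have "f y = (norm y / norm x) *\<^sub>R f x"
    by (metis assms(1) linear_scale)
  then show ?thesis
    using codirectional_scaleR[of "norm y / norm x" "f x"] by simp
qed (simp add: linear_0[OF assms(1)])

lemma codirectional_both_signs:
  fixes x y :: "'a::real_inner"
  assumes "codirectional x y" "codirectional x (- y)"
  shows "x = 0 \<or> y = 0"
proof -
  have "norm y *\<^sub>R x = norm x *\<^sub>R y" "norm y *\<^sub>R x = - (norm x *\<^sub>R y)"
    using assms by (simp_all add: codirectional_iff_scaleR)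
  then have "2 *\<^sub>R (norm y *\<^sub>R x) = 0"
    unfolding scaleR_2 by (metis add.right_inverse)
  then show ?thesis
    by auto
qed

lemma codirectional_inner_nonneg:
  fixes x y :: "'a::real_inner"
  assumes "codirectional x y"
  shows "inner x y \<ge> 0"
  using assms norm_cauchy_schwarz_eq[of x y] by (simp add: codirectional_iff_scaleR)

text \<open>
  The norm is the sum of the norms of the two parts, so the triangle inequality is an equality iff
  it is one in each part.
\<close>

lemma TEA_pair_iff_codirectional:
  "TEA_pair A B \<longleftrightarrow> codirectional (conformal_part A) (conformal_part B) \<and>
     codirectional (anticonformal_part A) (anticonformal_part B)"
  using norm_triangle_ineq[of "conformal_part A" "conformal_part B"]
    norm_triangle_ineq[of "anticonformal_part A" "anticonformal_part B"]
  unfolding TEA_pair_def spectral_norm_eq codirectional_def by auto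

lemma parallel_pair_iff_TEA: "parallel_pair A B \<longleftrightarrow> TEA_pair A B \<or> TEA_pair A (- B)"
  by (auto simp: parallel_pair_def TEA_pair_def spectral_norm_eq)

lemma TEA_imp_parallel_preserving:
  assumes "linear T" "preserves_TEA_pairs T"
  shows "preserves_parallel_pairs T"
  using assms(2) unfolding preserves_parallel_pairs_def preserves_TEA_pairs_def parallel_pair_iff_TEA
    linear_neg[OF assms(1), symmetric] by blast

section \<open>Decoupled maps and TEA pairs\<close>

text \<open>
  Regard \<open>T\<close> as a \<open>2 \<times> 2\<close> array of maps of the complex plane, with the parts of the image indexing
  rows and the parts of the argument indexing columns. The condition is that each row has a zero
  entry; equivalently, each part of \<open>T X\<close> depends on only one part of \<open>X\<close>.
\<close>

definition decoupled :: "(real^2^2 \<Rightarrow> real^2^2) \<Rightarrow> bool" where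
  "decoupled T \<longleftrightarrow>
     ((\<forall>p. conformal_part (T (matrix_of_parts p 0)) = 0) \<or>
      (\<forall>q. conformal_part (T (matrix_of_parts 0 q)) = 0)) \<and>
     ((\<forall>p. anticonformal_part (T (matrix_of_parts p 0)) = 0) \<or>
      (\<forall>q. anticonformal_part (T (matrix_of_parts 0 q)) = 0))"

lemma image_split:
  assumes "linear T"
  shows "T X = T (matrix_of_parts (conformal_part X) 0) + T (matrix_of_parts 0 (anticonformal_part X))"
  unfolding linear_add[OF assms, symmetric] matrix_split[of X, symmetric] ..

lemma linear_blocks:
  assumes "linear T"
  shows "linear (\<lambda>p. conformal_part (T (matrix_of_parts p 0)))"
    "linear (\<lambda>p. anticonformal_part (T (matrix_of_parts p 0)))"
    "linear (\<lambda>q. conformal_part (T (matrix_of_parts 0 q)))"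
    "linear (\<lambda>q. anticonformal_part (T (matrix_of_parts 0 q)))"
  using linear_matrix_of_parts[THEN linear_compose[OF _ assms]]
    linear_compose[OF _ linear_parts(1)] linear_compose[OF _ linear_parts(2)]
  unfolding o_def by blast+

lemma decoupled_imp_preserves_TEA:
  assumes T: "linear T" and "decoupled T"
  shows "preserves_TEA_pairs T"
  unfolding preserves_TEA_pairs_def
proof (intro allI impI)
  fix A B assume "TEA_pair A B"
  then have AB: "codirectional (conformal_part A) (conformal_part B)"
    "codirectional (anticonformal_part A) (anticonformal_part B)"
    by (auto simp: TEA_pair_iff_codirectional)
  note images = AB[THEN codirectional_linear_image[rotated]]
  show "TEA_pair (T A) (T B)"
    unfolding TEA_pair_iff_codirectional image_split[OF T, of A] image_split[OF T, of B]
    using \<open>decoupled T\<close> images(1)[OF linear_blocks(1)[OF T]] images(1)[OF linear_blocks(2)[OF T]]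
      images(2)[OF linear_blocks(3)[OF T]] images(2)[OF linear_blocks(4)[OF T]]
    by (auto simp: decoupled_def)
qed

text \<open>
  A conformal matrix forms a TEA pair with an anticonformal one and also with its negative. The same
  then holds for the images, but a nonzero complex number cannot be codirectional with both a nonzero
  number and its negative.
\<close>

lemma preserves_TEA_imp_decoupled:
  assumes T: "linear T" and TEA: "preserves_TEA_pairs T"
  shows "decoupled T"
proof -
  have "conformal_part (T (matrix_of_parts p 0)) = 0 \<or> conformal_part (T (matrix_of_parts 0 q)) = 0"
    "anticonformal_part (T (matrix_of_parts p 0)) = 0 \<or> anticonformal_part (T (matrix_of_parts 0 q)) = 0"
    for p q
  proof -
    have "TEA_pair (matrix_of_parts p 0) (matrix_of_parts 0 q)"
      "TEA_pair (matrix_of_parts p 0) (- matrix_of_parts 0 q)"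
      by (auto simp: TEA_pair_iff_codirectional)
    then have "TEA_pair (T (matrix_of_parts p 0)) (T (matrix_of_parts 0 q))"
      "TEA_pair (T (matrix_of_parts p 0)) (- T (matrix_of_parts 0 q))"
      using TEA by (auto simp: preserves_TEA_pairs_def simp flip: linear_neg[OF T])
    then show "conformal_part (T (matrix_of_parts p 0)) = 0 \<or> conformal_part (T (matrix_of_parts 0 q)) = 0"
      "anticonformal_part (T (matrix_of_parts p 0)) = 0 \<or> anticonformal_part (T (matrix_of_parts 0 q)) = 0"
      by (auto simp: TEA_pair_iff_codirectional dest: codirectional_both_signs)
  qed
  then show ?thesis
    unfolding decoupled_def by blast
qed

section \<open>Maps that depend on one part only\<close>

text \<open>
  The real and imaginary part of the conformal part of \<open>X\<close> are half the traces of \<open>X\<close> and of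
  \<open>mat_R3 ** X\<close>; \<open>mat_R3\<close> has conformal part \<open>- \<i>\<close>, which accounts for the signs.
\<close>

lemma two_trace_form_if_ignores_anticonformal:
  assumes T: "linear T" and "\<And>q. T (matrix_of_parts 0 q) = 0"
  shows "two_trace_form T"
proof -
  have "T X = trace (mat 1 ** X) *\<^sub>R (T (mat 1) /\<^sub>R 2) + trace (mat_R3 ** X) *\<^sub>R (- T mat_R3 /\<^sub>R 2)"
    for X
  proof -
    have "matrix_of_parts (conformal_part X) 0 =
        Re (conformal_part X) *\<^sub>R mat 1 - Im (conformal_part X) *\<^sub>R mat_R3"
      by (simp add: matrix_eq_iff_parts complex_eq_iff)
    then have "T X = Re (conformal_part X) *\<^sub>R T (mat 1) - Im (conformal_part X) *\<^sub>R T mat_R3"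
      using image_split[OF T, of X] assms(2) by (simp add: linear_diff[OF T] linear_scale[OF T])
    then show ?thesis
      by (simp add: trace_eq_Re_conformal_part)
  qed
  moreover have "orthogonal_matrix (mat 1 :: real^2^2)" "orthogonal_matrix mat_R3"
    "transpose (mat 1) ** mat_R3 = mat_R3"
    by (simp_all add: orthogonal_matrix_iff_parts)
  ultimately show ?thesis
    unfolding two_trace_form_def by blast
qed

lemma two_trace_form_if_ignores_conformal:
  assumes T: "linear T" and "\<And>p. T (matrix_of_parts p 0) = 0"
  shows "two_trace_form T"
proof -
  have "T X = trace (mat_R1 ** X) *\<^sub>R (T mat_R1 /\<^sub>R 2) + trace (mat_R2 ** X) *\<^sub>R (T mat_R2 /\<^sub>R 2)"
    for X
  proof -
    have "matrix_of_parts 0 (anticonformal_part X) =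
        Re (anticonformal_part X) *\<^sub>R mat_R1 + Im (anticonformal_part X) *\<^sub>R mat_R2"
      by (simp add: matrix_eq_iff_parts complex_eq_iff)
    then have "T X = Re (anticonformal_part X) *\<^sub>R T mat_R1 + Im (anticonformal_part X) *\<^sub>R T mat_R2"
      using image_split[OF T, of X] assms(2) by (simp add: linear_add[OF T] linear_scale[OF T])
    then show ?thesis
      by (simp add: trace_eq_Re_conformal_part)
  qed
  moreover have "orthogonal_matrix mat_R1" "orthogonal_matrix mat_R2" "transpose mat_R1 ** mat_R2 = mat_R3"
    by (simp_all add: orthogonal_matrix_iff_parts matrix_eq_iff_parts)
  ultimately show ?thesis
    unfolding two_trace_form_def by blast
qed

text \<open>
  Since \<open>F2 = F1 ** mat_R3\<close> and \<open>mat_R3\<close> is a rotation, \<open>F1\<close> and \<open>F2\<close> are both rotations or both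
  reflections. So both traces see only the conformal part of \<open>X\<close>, or both see only the anticonformal
  part, and one column of the array is zero.
\<close>

lemma two_trace_form_imp_decoupled:
  assumes "two_trace_form T"
  shows "decoupled T"
proof -
  obtain F1 F2 Z1 Z2 where F: "orthogonal_matrix F1" "transpose F1 ** F2 = mat_R3"
    and T: "\<And>X. T X = trace (F1 ** X) *\<^sub>R Z1 + trace (F2 ** X) *\<^sub>R Z2"
    using assms unfolding two_trace_form_def by blast
  have "F2 = F1 ** mat_R3"
    using F by (metis matrix_mul_assoc matrix_mul_lid orthogonal_matrix_def)
  then show ?thesis
    using F(1) unfolding orthogonal_matrix_iff_parts decoupled_def
    by (elim disjE) (auto simp: T trace_eq_Re_conformal_part)
qed

section \<open>Diagonal form\<close>

lemma diagonal_form_iff_eigenbasis: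
  "diagonal_form T \<longleftrightarrow>
     (\<exists>U1 U2 V1 V2 d. orthogonal_matrix U1 \<and> orthogonal_matrix U2 \<and>
        orthogonal_matrix V1 \<and> orthogonal_matrix V2 \<and>
        (\<forall>j. U1 ** T (U2 ** basis_R $ j ** V2) ** V1 = d j *\<^sub>R basis_R $ j))"
proof -
  have "(\<exists>d0 d1 d2 d3. matrix_rep basis_R S =
      vector [vector [d0, 0, 0, 0], vector [0, d1, 0, 0], vector [0, 0, d2, 0], vector [0, 0, 0, d3]])
     \<longleftrightarrow> (\<exists>d. \<forall>j. S (basis_R $ j) = d j *\<^sub>R basis_R $ j)" (is "?L \<longleftrightarrow> ?R") for S
  proof
    assume ?L
    then obtain d0 d1 d2 d3 where m: "matrix_rep basis_R S =
      vector [vector [d0, 0, 0, 0], vector [0, d1, 0, 0], vector [0, 0, d2, 0], vector [0, 0, 0, d3]]"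
      by blast
    have "S (basis_R $ j) = matrix_rep basis_R S $ j $ j *\<^sub>R basis_R $ j" for j
    proof -
      have "\<forall>j. S (basis_R $ j) = matrix_rep basis_R S $ j $ j *\<^sub>R basis_R $ j"
        unfolding forall_4 matrix_rep_basis_R[of S] sum_4 m by simp
      then show ?thesis ..
    qed
    then show ?R
      by (intro exI[of _ "\<lambda>j. matrix_rep basis_R S $ j $ j"]) blast
  next
    assume ?R
    then obtain d where d: "\<And>j. S (basis_R $ j) = d j *\<^sub>R basis_R $ j"
      by blast
    let ?B = "range (($) basis_R)"
    have "matrix_rep basis_R S $ i $ j = (if i = j then d j else 0)" for i j
    proof -
      have "representation ?B (d j *\<^sub>R basis_R $ j) (basis_R $ i) =
          d j * (if basis_R $ j = basis_R $ i then 1 else 0)"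
        using basis_R_basis by (simp add: real_vector.representation_scale real_vector.representation_basis)
      then show ?thesis
        using injD[OF basis_R_basis(1), of i j] by (auto simp: matrix_rep_def d)
    qed
    then have "matrix_rep basis_R S =
      vector [vector [d 1, 0, 0, 0], vector [0, d 2, 0, 0], vector [0, 0, d 3, 0], vector [0, 0, 0, d 4]]"
      by (simp add: vec_eq_iff forall_4)
    then show ?L
      by blast
  qed
  note eq = this
  show ?thesis
    unfolding diagonal_form_def eq by blast
qed

lemma basis_R_components:
  "basis_R $ 1 = mat 1 /\<^sub>R sqrt 2" "basis_R $ 2 = mat_R1 /\<^sub>R sqrt 2"
  "basis_R $ 3 = mat_R2 /\<^sub>R sqrt 2" "basis_R $ 4 = mat_R3 /\<^sub>R sqrt 2"
  by (simp_all add: basis_R_def)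

lemma real_linear_complex_split:
  assumes "linear (f :: complex \<Rightarrow> complex)"
  obtains p q where "\<And>z. f z = p * z + q * cnj z"
proof
  fix z
  have "f z = f (Re z *\<^sub>R 1 + Im z *\<^sub>R \<i>)"
    by (intro arg_cong[of _ _ f]) (simp add: complex_eq_iff)
  also have "\<dots> = Re z *\<^sub>R f 1 + Im z *\<^sub>R f \<i>"
    by (simp only: linear_add[OF assms] linear_scale[OF assms])
  also have "\<dots> = ((f 1 - \<i> * f \<i>) / 2) * z + ((f 1 + \<i> * f \<i>) / 2) * cnj z"
    by (simp add: complex_eq_iff field_simps)
  finally show "f z = ((f 1 - \<i> * f \<i>) / 2) * z + ((f 1 + \<i> * f \<i>) / 2) * cnj z" .
qed

text \<open>
  A singular value decomposition by rotations: \<open>w (a z + b cnj z)\<close> with real \<open>a\<close> and \<open>b\<close> equals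
  \<open>f (u z)\<close> once \<open>u\<close> aligns the two coefficients of \<open>f\<close> along \<open>w\<close>. The diagonal entries are
  \<open>a + b\<close> and \<open>a - b\<close>, so the second one may be negative.
\<close>

lemma real_linear_complex_svd:
  assumes "linear (f :: complex \<Rightarrow> complex)"
  obtains u w and d d' :: real where "cmod u = 1" "cmod w = 1"
    "cnj w * f u = of_real d" "cnj w * f (u * \<i>) = of_real d' * \<i>"
proof -
  obtain p q where f: "\<And>z. f z = p * z + q * cnj z"
    using real_linear_complex_split[OF assms] by blast
  obtain u w where u: "cmod u = 1" "cmod w = 1" "p * u = of_real (cmod p) * w"
    "q * cnj u = of_real (cmod q) * w"
    by (rule exists_aligning_rotation)
  have w: "cnj w * w = 1"
    using u(2) complex_norm_square[of w] by (simp add: mult.commute)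
  have "f u = w * of_real (cmod p + cmod q)"
    using u(3,4) by (simp add: f algebra_simps)
  then have 1: "cnj w * f u = of_real (cmod p + cmod q)"
    using w by (simp only: mult.assoc[symmetric]) simp
  have "f (u * \<i>) = (p * u) * \<i> - (q * cnj u) * \<i>"
    by (simp add: f)
  also have "\<dots> = w * (of_real (cmod p - cmod q) * \<i>)"
    unfolding u(3,4) by (simp add: algebra_simps)
  finally have 2: "cnj w * f (u * \<i>) = of_real (cmod p - cmod q) * \<i>"
    using w by (simp only: mult.assoc[symmetric]) simp
  show thesis
    using that[OF u(1,2) 1 2] .
qed

text \<open>
  Rotations by \<open>w\<close> from the left and \<open>z\<close> from the right multiply the parts by \<open>w z\<close> and \<open>w cnj z\<close>,
  and these two products can be prescribed: \<open>z\<close> has half the difference and \<open>w\<close> half the sum of the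
  two arguments.
\<close>

lemma rotate_parts_independently:
  assumes "cmod u = 1" "cmod v = 1"
  obtains U V where "orthogonal_matrix U" "orthogonal_matrix V"
    "\<And>A. conformal_part (U ** A ** V) = u * conformal_part A"
    "\<And>A. anticonformal_part (U ** A ** V) = v * anticonformal_part A"
proof -
  obtain z w where z: "cmod z = 1" "cmod w = 1" "v * z = w" "u * cnj z = w"
    using exists_aligning_rotation[of v u] assms by auto
  have zz: "z * cnj z = 1"
    using z(1) complex_norm_square[of z] by simp
  have wz: "w * z = u" "w * cnj z = v"
    using zz z(3,4) by (metis mult.assoc mult.commute mult.right_neutral)+
  show thesis
  proof
    show "orthogonal_matrix (matrix_of_parts w 0)" "orthogonal_matrix (matrix_of_parts z 0)"
      using z by (simp_all add: orthogonal_matrix_iff_parts)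
    show "conformal_part (matrix_of_parts w 0 ** A ** matrix_of_parts z 0) = u * conformal_part A"
      "anticonformal_part (matrix_of_parts w 0 ** A ** matrix_of_parts z 0) = v * anticonformal_part A"
      for A
      by (simp_all add: mult.assoc mult.left_commute flip: wz)
  qed
qed

lemma diagonal_form_if_block_diagonal:
  assumes T: "linear T"
    and conf: "\<And>p. anticonformal_part (T (matrix_of_parts p 0)) = 0"
    and anti: "\<And>q. conformal_part (T (matrix_of_parts 0 q)) = 0"
  shows "diagonal_form T"
proof -
  define f where "f = (\<lambda>p. conformal_part (T (matrix_of_parts p 0)))"
  define g where "g = (\<lambda>q. anticonformal_part (T (matrix_of_parts 0 q)))"
  have fg: "linear f" "linear g"
    unfolding f_def g_def by (rule linear_blocks[OF T])+
  have Tparts: "conformal_part (T X) = f (conformal_part X)"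
    "anticonformal_part (T X) = g (anticonformal_part X)" for X
    using image_split[OF T, of X] conf anti by (simp_all add: f_def g_def)
  obtain u w d0 d3 where u: "cmod u = 1" "cmod w = 1"
    "cnj w * f u = of_real d0" "cnj w * f (u * \<i>) = of_real d3 * \<i>"
    using real_linear_complex_svd[OF fg(1)] .
  obtain u' w' d1 d2 where u': "cmod u' = 1" "cmod w' = 1"
    "cnj w' * g u' = of_real d1" "cnj w' * g (u' * \<i>) = of_real d2 * \<i>"
    using real_linear_complex_svd[OF fg(2)] .
  obtain U1 V1 where UV1: "orthogonal_matrix U1" "orthogonal_matrix V1"
    "\<And>A. conformal_part (U1 ** A ** V1) = cnj w * conformal_part A"
    "\<And>A. anticonformal_part (U1 ** A ** V1) = cnj w' * anticonformal_part A"
    using rotate_parts_independently[of "cnj w" "cnj w'"] u(2) u'(2) by auto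
  obtain U2 V2 where UV2: "orthogonal_matrix U2" "orthogonal_matrix V2"
    "\<And>A. conformal_part (U2 ** A ** V2) = u * conformal_part A"
    "\<And>A. anticonformal_part (U2 ** A ** V2) = u' * anticonformal_part A"
    using rotate_parts_independently[OF u(1) u'(1)] by blast
  \<comment> \<open>The first and last basis matrices are the conformal ones.\<close>
  define d :: "4 \<Rightarrow> real" where "d = ($) (vector [d0, d1, d2, d3])"
  have d: "d 1 = d0" "d 2 = d1" "d 3 = d2" "d 4 = d3"
    by (simp_all add: d_def)
  have "\<forall>j. U1 ** T (U2 ** basis_R $ j ** V2) ** V1 = d j *\<^sub>R basis_R $ j"
    unfolding forall_4 d basis_R_components matrix_eq_iff_parts UV1 Tparts UV2 using u u'
    by (simp add: linear_scale[OF fg(1)] linear_scale[OF fg(2)] linear_0[OF fg(1)] linear_0[OF fg(2)]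
        linear_neg[OF fg(1)] complex_eq_iff)
  then show ?thesis
    unfolding diagonal_form_iff_eigenbasis using UV1(1,2) UV2(1,2) by blast
qed

text \<open>
  Multiplication by the reflection \<open>mat_R1\<close> turns an antidiagonal array into a diagonal one, and
  reduces statements about the anticonformal row to the conformal row.
\<close>

lemma mult_R1_swaps_parts [simp]:
  "conformal_part (A ** mat_R1) = anticonformal_part A"
  "anticonformal_part (A ** mat_R1) = conformal_part A"
  by simp_all

lemma mult_R1_R1 [simp]: "(A :: real^2^2) ** mat_R1 ** mat_R1 = A"
  by (simp add: matrix_eq_iff_parts)

lemma linear_mult_R1:
  fixes T :: "real^2^2 \<Rightarrow> real^2^2"
  assumes "linear T" shows "linear (\<lambda>X. T X ** mat_R1)"
  by (rule linearI)
    (simp_all add: linear_add[OF assms] linear_scale[OF assms] matrix_eq_iff_parts)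

lemma diagonal_form_mult_R1:
  assumes "diagonal_form (\<lambda>X. T X ** mat_R1)"
  shows "diagonal_form T"
proof -
  obtain U1 U2 V1 V2 d where UV: "orthogonal_matrix U1" "orthogonal_matrix U2"
    "orthogonal_matrix V1" "orthogonal_matrix V2"
    "\<And>j. U1 ** (T (U2 ** basis_R $ j ** V2) ** mat_R1) ** V1 = d j *\<^sub>R basis_R $ j"
    using assms unfolding diagonal_form_iff_eigenbasis by blast
  have "orthogonal_matrix (mat_R1 ** V1)"
    using UV(3) by (intro orthogonal_matrix_mul) (simp_all add: orthogonal_matrix_iff_parts)
  moreover have "U1 ** T (U2 ** basis_R $ j ** V2) ** (mat_R1 ** V1) = d j *\<^sub>R basis_R $ j" for j
    using UV(5) by (simp add: matrix_mul_assoc)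
  ultimately show ?thesis
    unfolding diagonal_form_iff_eigenbasis using UV(1,2,4) by blast
qed

lemma decoupled_imp_form:
  assumes T: "linear T" and dec: "decoupled T"
  shows "two_trace_form T \<or> diagonal_form T"
proof -
  consider (conf) "\<And>p. T (matrix_of_parts p 0) = 0" | (anti) "\<And>q. T (matrix_of_parts 0 q) = 0"
    | (diag) "\<And>p. anticonformal_part (T (matrix_of_parts p 0)) = 0"
       "\<And>q. conformal_part (T (matrix_of_parts 0 q)) = 0"
    | (swap) "\<And>p. conformal_part (T (matrix_of_parts p 0)) = 0"
       "\<And>q. anticonformal_part (T (matrix_of_parts 0 q)) = 0"
    using dec unfolding decoupled_def matrix_eq_iff_parts parts_zero by blast
  then show ?thesis
  proof cases
    case conf
    then show ?thesis using two_trace_form_if_ignores_conformal[OF T] by blast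
  next
    case anti
    then show ?thesis using two_trace_form_if_ignores_anticonformal[OF T] by blast
  next
    case diag
    then show ?thesis using diagonal_form_if_block_diagonal[OF T] by blast
  next
    case swap
    then have "diagonal_form (\<lambda>X. T X ** mat_R1)"
      by (intro diagonal_form_if_block_diagonal linear_mult_R1 T) simp_all
    then show ?thesis using diagonal_form_mult_R1 by blast
  qed
qed

lemma spectral_norm_orthogonal_mult:
  assumes "orthogonal_matrix U" "orthogonal_matrix V"
  shows "spectral_norm (U ** A ** V) = spectral_norm A"
  using assms unfolding orthogonal_matrix_iff_parts
  by (elim disjE conjE) (simp_all add: spectral_norm_eq norm_mult)

lemma preserves_TEA_orthogonal_mult:
  assumes "orthogonal_matrix U" "orthogonal_matrix V"
  shows "preserves_TEA_pairs (\<lambda>A. U ** A ** V)"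
  unfolding preserves_TEA_pairs_def TEA_pair_def
proof (intro allI impI)
  fix A B assume "spectral_norm (A + B) = spectral_norm A + spectral_norm B"
  moreover have "U ** A ** V + U ** B ** V = U ** (A + B) ** V"
    by (simp add: matrix_eq_iff_parts algebra_simps)
  ultimately show "spectral_norm (U ** A ** V + U ** B ** V) =
      spectral_norm (U ** A ** V) + spectral_norm (U ** B ** V)"
    by (simp only: spectral_norm_orthogonal_mult[OF assms])
qed

text \<open>
  The first and fourth basis matrices span the conformal matrices, the second and third the
  anticonformal ones. So a map that is diagonal in the basis is decoupled, and the orthogonal factors
  around it are isometries of the spectral norm.
\<close>

lemma diagonal_form_imp_preserves_TEA:
  assumes T: "linear T" and "diagonal_form T"
  shows "preserves_TEA_pairs T"
proof -
  obtain U1 U2 V1 V2 d where UV: "orthogonal_matrix U1" "orthogonal_matrix U2"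
    "orthogonal_matrix V1" "orthogonal_matrix V2"
    and d: "\<And>j. U1 ** T (U2 ** basis_R $ j ** V2) ** V1 = d j *\<^sub>R basis_R $ j"
    using assms(2) unfolding diagonal_form_iff_eigenbasis by blast
  define S where "S = (\<lambda>A. U1 ** T (U2 ** A ** V2) ** V1)"
  have S: "linear S"
    unfolding S_def
    using linear_mult_both[OF linear_compose[OF linear_mult_both[OF linear_ident] T]]
    by (simp add: o_def)
  have Sd: "U1 ** T (U2 ** A ** V2) ** V1 = S A" for A
    by (simp add: S_def)
  have eig: "S (mat 1) = d 1 *\<^sub>R mat 1" "S mat_R1 = d 2 *\<^sub>R mat_R1"
     "S mat_R2 = d 3 *\<^sub>R mat_R2" "S mat_R3 = d 4 *\<^sub>R mat_R3"
    using d[of 1] d[of 2] d[of 3] d[of 4]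
    unfolding basis_R_components Sd linear_scale[OF S] scaleR_left_commute[of "d _"]
    by (simp_all only: scaleR_cancel_left) simp_all
  have "S (matrix_of_parts p 0) = matrix_of_parts (Complex (d 1 * Re p) (d 4 * Im p)) 0" for p
  proof -
    have "matrix_of_parts p 0 = Re p *\<^sub>R mat 1 + (- Im p) *\<^sub>R mat_R3"
      by (simp add: matrix_eq_iff_parts complex_eq_iff)
    then have "S (matrix_of_parts p 0) = Re p *\<^sub>R S (mat 1) + (- Im p) *\<^sub>R S mat_R3"
      by (simp only: linear_add[OF S] linear_scale[OF S])
    then show ?thesis
      by (simp add: eig matrix_eq_iff_parts complex_eq_iff)
  qed
  moreover have "S (matrix_of_parts 0 q) = matrix_of_parts 0 (Complex (d 2 * Re q) (d 3 * Im q))" for q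
  proof -
    have "matrix_of_parts 0 q = Re q *\<^sub>R mat_R1 + Im q *\<^sub>R mat_R2"
      by (simp add: matrix_eq_iff_parts complex_eq_iff)
    then have "S (matrix_of_parts 0 q) = Re q *\<^sub>R S mat_R1 + Im q *\<^sub>R S mat_R2"
      by (simp only: linear_add[OF S] linear_scale[OF S])
    then show ?thesis
      by (simp add: eig matrix_eq_iff_parts complex_eq_iff)
  qed
  ultimately have "decoupled S"
    by (simp add: decoupled_def)
  then have "preserves_TEA_pairs S"
    by (rule decoupled_imp_preserves_TEA[OF S])
  moreover have "T A = transpose U1 ** S (transpose U2 ** A ** transpose V2) ** transpose V1" for A
  proof -
    have "U2 ** (transpose U2 ** A ** transpose V2) ** V2 = A"
    proof -
      have "U2 ** (transpose U2 ** A ** transpose V2) ** V2 =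
          (U2 ** transpose U2) ** A ** (transpose V2 ** V2)"
        by (simp only: matrix_mul_assoc)
      then show ?thesis
        using UV by (simp add: orthogonal_matrix_def)
    qed
    moreover have "transpose U1 ** (U1 ** B ** V1) ** transpose V1 = B" for B
    proof -
      have "transpose U1 ** (U1 ** B ** V1) ** transpose V1 =
          (transpose U1 ** U1) ** B ** (V1 ** transpose V1)"
        by (simp only: matrix_mul_assoc)
      then show ?thesis
        using UV by (simp add: orthogonal_matrix_def)
    qed
    ultimately show ?thesis
      by (simp add: S_def)
  qed
  moreover have "preserves_TEA_pairs (\<lambda>A. transpose U1 ** A ** transpose V1)"
     "preserves_TEA_pairs (\<lambda>A. transpose U2 ** A ** transpose V2)"
    using UV by (simp_all add: preserves_TEA_orthogonal_mult orthogonal_matrix_transpose)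
  ultimately show ?thesis
    unfolding preserves_TEA_pairs_def by simp
qed

section \<open>Parallel pairs\<close>

text \<open>
  The same sign \<open>\<mu>\<close> makes both pairs of parts codirectional, so the two inner products cannot have
  opposite signs.
\<close>

lemma parallel_pair_inner_nonneg:
  assumes "parallel_pair A B"
  shows "0 \<le> inner (conformal_part A) (conformal_part B) * inner (anticonformal_part A) (anticonformal_part B)"
  using assms codirectional_inner_nonneg[of "conformal_part A" "conformal_part B"]
    codirectional_inner_nonneg[of "anticonformal_part A" "anticonformal_part B"]
    codirectional_inner_nonneg[of "conformal_part A" "- conformal_part B"]
    codirectional_inner_nonneg[of "anticonformal_part A" "- anticonformal_part B"]
  by (auto simp: parallel_pair_iff_TEA TEA_pair_iff_codirectional intro: mult_nonneg_nonneg mult_nonpos_nonpos)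

lemma linear_coefficient_zero:
  fixes c b :: real
  assumes "\<And>e. 0 \<le> c * e + b * e\<^sup>2"
  shows "c = 0"
proof -
  \<comment> \<open>At \<open>e = - c / m\<close> the expression is \<open>c\<^sup>2 (b - m) / m\<^sup>2\<close>, which is negative unless \<open>c = 0\<close>.\<close>
  define m where "m = 1 + \<bar>b\<bar>"
  have m: "m > 0" "b - m \<le> -1"
    by (auto simp: m_def)
  have "0 \<le> (c * (- c / m) + b * (- c / m)\<^sup>2) * m\<^sup>2"
    using assms[of "- c / m"] by simp
  also have "\<dots> = c\<^sup>2 * (b - m)"
    using m(1) by (simp add: field_simps power2_eq_square)
  also have "\<dots> \<le> c\<^sup>2 * -1"
    using m(2) by (intro mult_left_mono) auto
  finally show ?thesis
    by simp
qed

text \<open>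
  Let \<open>A\<close> and \<open>B\<close> be the two images. Their conformal parts are parallel, so they satisfy \<open>b = k a\<close>,
  and the conformal part \<open>(1 + t k) a\<close> of \<open>A + t B\<close> changes direction at \<open>t = - 1 / k\<close>. Write \<open>x\<close> and
  \<open>y\<close> for the anticonformal parts. Since \<open>A + t B\<close> is parallel to \<open>A\<close> and to \<open>B\<close>, the inner products
  of \<open>x + t y\<close> with \<open>x\<close> and with \<open>y\<close> are zero at the same \<open>t\<close>. Hence \<open>x - y / k\<close> is
  orthogonal to \<open>x\<close> and \<open>y\<close>, so it is zero.
\<close>

lemma parallel_preserver_images_proportional:
  assumes T: "linear T" and par: "preserves_parallel_pairs T"
    and nz: "conformal_part (T (matrix_of_parts p 0)) \<noteq> 0"
      "conformal_part (T (matrix_of_parts 0 q)) \<noteq> 0"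
  obtains k where "k \<noteq> 0" "T (matrix_of_parts 0 q) = k *\<^sub>R T (matrix_of_parts p 0)"
proof -
  let ?A = "T (matrix_of_parts p 0)" and ?B = "T (matrix_of_parts 0 q)"
  let ?a = "conformal_part ?A" and ?b = "conformal_part ?B"
  let ?x = "anticonformal_part ?A" and ?y = "anticonformal_part ?B"
  have self: "codirectional z z" for z :: complex
    using codirectional_scaleR[of 1 z] by simp
  have "parallel_pair (matrix_of_parts p 0) (matrix_of_parts 0 q)"
    by (simp add: parallel_pair_iff_TEA TEA_pair_iff_codirectional)
  then have "parallel_pair ?A ?B"
    using par by (simp add: preserves_parallel_pairs_def)
  then have "codirectional ?a ?b \<or> codirectional ?a (- ?b)"
    by (auto simp: parallel_pair_iff_TEA TEA_pair_iff_codirectional)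
  then have "norm ?a *\<^sub>R ?b = norm ?b *\<^sub>R ?a \<or> norm ?a *\<^sub>R ?b = (- norm ?b) *\<^sub>R ?a"
    by (auto simp: codirectional_iff_scaleR minus_equation_iff)
  then obtain s where s: "norm ?a *\<^sub>R ?b = s *\<^sub>R ?a"
    by blast
  define k where "k = s / norm ?a"
  have "norm ?a *\<^sub>R ?b = norm ?a *\<^sub>R (k *\<^sub>R ?a)"
    using s nz(1) by (simp add: k_def)
  then have b: "?b = k *\<^sub>R ?a"
    using nz(1) by (simp only: scaleR_cancel_left) simp
  have k: "k \<noteq> 0"
    using b nz(2) by auto
  have pos: "inner ?a ?a > 0"
    using nz(1) by simp
  have image: "T (matrix_of_parts p (t *\<^sub>R q)) = ?A + t *\<^sub>R ?B" for t
    using image_split[OF T, of "matrix_of_parts p (t *\<^sub>R q)"]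
      linear_scale[OF linear_matrix_of_parts(2)] linear_scale[OF T] by simp
  have parA: "parallel_pair (?A + t *\<^sub>R ?B) ?A" for t
    using par unfolding preserves_parallel_pairs_def image[symmetric]
    by (simp add: parallel_pair_iff_TEA TEA_pair_iff_codirectional self)
  have parB: "parallel_pair (?A + t *\<^sub>R ?B) ?B" for t
  proof -
    have "codirectional (t *\<^sub>R q) q \<or> codirectional (t *\<^sub>R q) (- q)"
    proof -
      have "norm (t *\<^sub>R q + q) = norm (t *\<^sub>R q) + norm q \<or>
          norm (t *\<^sub>R q - q) = norm (t *\<^sub>R q) + norm q"
        using norm_scaleR[of "t + 1" q] norm_scaleR[of "t - 1" q]
        by (cases "t \<ge> 0") (simp_all add: algebra_simps)
      then show ?thesis
        by (simp add: codirectional_def)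
    qed
    then have "parallel_pair (matrix_of_parts p (t *\<^sub>R q)) (matrix_of_parts 0 q)"
      by (auto simp: parallel_pair_iff_TEA TEA_pair_iff_codirectional)
    then show ?thesis
      using par unfolding preserves_parallel_pairs_def image[symmetric] by blast
  qed
  \<comment> \<open>With \<open>t = e - 1 / k\<close>, both products of inner products are quadratics in \<open>e\<close> that vanish at
    \<open>e = 0\<close> and stay nonnegative, so their linear coefficients are zero.\<close>
  let ?r = "?x - (1 / k) *\<^sub>R ?y"
  have "0 \<le> (k * inner ?a ?a * inner ?r ?x) * e + (k * inner ?a ?a * inner ?y ?x) * e\<^sup>2" for e
    using parallel_pair_inner_nonneg[OF parA[of "e - 1 / k"]] k
    by (simp add: b inner_simps algebra_simps power2_eq_square)
  then have "k * inner ?a ?a * inner ?r ?x = 0"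
    by (rule linear_coefficient_zero)
  then have rx: "inner ?r ?x = 0"
    using k pos by simp
  have "0 \<le> (k\<^sup>2 * inner ?a ?a * inner ?r ?y) * e + (k\<^sup>2 * inner ?a ?a * inner ?y ?y) * e\<^sup>2" for e
    using parallel_pair_inner_nonneg[OF parB[of "e - 1 / k"]] k
    by (simp add: b inner_simps algebra_simps power2_eq_square)
  then have "k\<^sup>2 * inner ?a ?a * inner ?r ?y = 0"
    by (rule linear_coefficient_zero)
  then have ry: "inner ?r ?y = 0"
    using k pos by simp
  have "inner ?r ?r = inner ?r ?x - (1 / k) * inner ?r ?y"
    by (simp only: inner_diff_right inner_scaleR_right)
  then have "?r = 0"
    using rx ry by simp
  then have "?y = k *\<^sub>R ?x"
    using k by (simp add: field_simps)
  then have "?B = k *\<^sub>R ?A"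
    using b by (simp add: matrix_eq_iff_parts)
  then show thesis
    using that k by blast
qed

text \<open>
  The coefficient of \<open>T A\<close> along \<open>Z\<close> is \<open>T A \<bullet> Z / (Z \<bullet> Z)\<close>; moving \<open>T\<close> to the other side of the
  inner product makes it a trace. For \<open>Z = 0\<close> both sides are zero.
\<close>

lemma one_trace_form_if_range_in_line:
  assumes T: "linear T" and "range T \<subseteq> span {Z}"
  shows "one_trace_form T"
proof -
  let ?F = "transpose (adjoint T Z /\<^sub>R (Z \<bullet> Z))"
  have "T A = trace (?F ** A) *\<^sub>R Z" for A
  proof -
    obtain c where c: "T A = c *\<^sub>R Z"
      using assms(2) by (auto simp: span_singleton)
    have "trace (?F ** A) = T A \<bullet> Z / (Z \<bullet> Z)"
      by (simp add: trace_inner adjoint_works[OF T] divide_inverse_commute)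
    then show ?thesis
      by (simp add: c)
  qed
  then show ?thesis
    unfolding one_trace_form_def by blast
qed

text \<open>
  The images with nonzero conformal part of all conformal and all anticonformal matrices are
  proportional to one another, so they lie on one line. Images with zero conformal part are
  differences of two of these.
\<close>

lemma one_trace_form_if_conformal_blocks_nonzero:
  assumes T: "linear T" and par: "preserves_parallel_pairs T"
    and p0: "conformal_part (T (matrix_of_parts p0 0)) \<noteq> 0"
    and q0: "conformal_part (T (matrix_of_parts 0 q0)) \<noteq> 0"
  shows "one_trace_form T"
proof (rule one_trace_form_if_range_in_line[OF T])
  define Z where "Z = T (matrix_of_parts p0 0)"
  have in_span_if_generic: "f z \<in> span {Z}"
    if "linear f" "conformal_part (f z0) \<noteq> 0"
      "\<And>z. conformal_part (f z) \<noteq> 0 \<Longrightarrow> f z \<in> span {Z}" for f :: "complex \<Rightarrow> real^2^2" and z z0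
  proof (cases "conformal_part (f z) = 0")
    case True
    then have "f (z + z0) \<in> span {Z}"
      using that by (intro that(3)) (simp add: linear_add[OF that(1)])
    moreover have "f z = f (z + z0) - f z0"
      by (simp add: linear_add[OF that(1)])
    ultimately show ?thesis
      using that(2,3) by (metis span_diff)
  qed (rule that(3))
  have lin: "linear (\<lambda>p. T (matrix_of_parts p 0))" "linear (\<lambda>q. T (matrix_of_parts 0 q))"
    using linear_compose[OF linear_matrix_of_parts(1) T] linear_compose[OF linear_matrix_of_parts(2) T]
    by (simp_all add: o_def)
  have q: "T (matrix_of_parts 0 q) \<in> span {Z}" if nz: "conformal_part (T (matrix_of_parts 0 q)) \<noteq> 0" for q
  proof -
    obtain k where "T (matrix_of_parts 0 q) = k *\<^sub>R Z"
      using parallel_preserver_images_proportional[OF T par p0 nz] by (metis Z_def)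
    then show ?thesis
      by (simp add: span_base span_scale)
  qed
  have p: "T (matrix_of_parts p 0) \<in> span {Z}" if nz: "conformal_part (T (matrix_of_parts p 0)) \<noteq> 0" for p
  proof -
    obtain k where k: "k \<noteq> 0" "T (matrix_of_parts 0 q0) = k *\<^sub>R T (matrix_of_parts p 0)"
      using parallel_preserver_images_proportional[OF T par nz q0] by blast
    then have "T (matrix_of_parts p 0) = (1 / k) *\<^sub>R T (matrix_of_parts 0 q0)"
      by simp
    then show ?thesis
      using q[OF q0] by (simp add: span_scale)
  qed
  show "range T \<subseteq> span {Z}"
    using in_span_if_generic[OF lin(1) p0 p] in_span_if_generic[OF lin(2) q0 q]
    by (intro image_subsetI) (subst image_split[OF T], simp add: span_add)
qed

lemma preserves_parallel_imp_decoupled_or_one_trace: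
  assumes T: "linear T" and par: "preserves_parallel_pairs T"
  shows "decoupled T \<or> one_trace_form T"
proof (cases "decoupled T")
  case False
  then consider (conf) p q where "conformal_part (T (matrix_of_parts p 0)) \<noteq> 0"
      "conformal_part (T (matrix_of_parts 0 q)) \<noteq> 0"
    | (anti) p q where "anticonformal_part (T (matrix_of_parts p 0)) \<noteq> 0"
      "anticonformal_part (T (matrix_of_parts 0 q)) \<noteq> 0"
    unfolding decoupled_def by blast
  then show ?thesis
  proof cases
    case conf
    then show ?thesis
      using one_trace_form_if_conformal_blocks_nonzero[OF T par] by blast
  next
    case anti
    have "preserves_parallel_pairs (\<lambda>X. T X ** mat_R1)"
      using par by (simp add: preserves_parallel_pairs_def parallel_pair_iff_TEA
          TEA_pair_iff_codirectional conj_commute)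
    then have "one_trace_form (\<lambda>X. T X ** mat_R1)"
      using anti
      by (intro one_trace_form_if_conformal_blocks_nonzero[OF linear_mult_R1[OF T]]) simp_all
    then obtain F Z where FZ: "\<And>X. T X ** mat_R1 = trace (F ** X) *\<^sub>R Z"
      unfolding one_trace_form_def by blast
    have "T X = trace (F ** X) *\<^sub>R (Z ** mat_R1)" for X
      using arg_cong[OF FZ[of X], of "\<lambda>Y. Y ** mat_R1"]
      by (simp add: linear_scale[OF linear_mult_R1[OF linear_ident]])
    then show ?thesis
      unfolding one_trace_form_def by blast
  qed
qed simp

lemma one_trace_form_preserves_parallel:
  assumes "one_trace_form T"
  shows "preserves_parallel_pairs T"
proof -
  obtain F Z where T: "\<And>A. T A = trace (F ** A) *\<^sub>R Z"
    using assms unfolding one_trace_form_def by blast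
  have "parallel_pair (s *\<^sub>R Z) (t *\<^sub>R Z)" for s t
  proof -
    have "spectral_norm (r *\<^sub>R Z) = \<bar>r\<bar> * spectral_norm Z" for r
      by (simp add: spectral_norm_eq algebra_simps)
    moreover have "\<bar>s + t\<bar> = \<bar>s\<bar> + \<bar>t\<bar> \<or> \<bar>s - t\<bar> = \<bar>s\<bar> + \<bar>t\<bar>"
      by linarith
    ultimately show ?thesis
      unfolding parallel_pair_def
      by (auto simp flip: scaleR_add_left scaleR_diff_left distrib_right)
  qed
  then show ?thesis
    by (simp add: preserves_parallel_pairs_def T)
qed

section \<open>The classification\<close>

theorem theorem1p3:
  fixes T :: "real^2^2 \<Rightarrow> real^2^2"
  assumes "linear T"
  shows "(preserves_TEA_pairs T \<longleftrightarrow> two_trace_form T \<or> diagonal_form T) \<and>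
         (preserves_parallel_pairs T \<longleftrightarrow>
            two_trace_form T \<or> diagonal_form T \<or> one_trace_form T)"
proof -
  have "decoupled T \<longleftrightarrow> preserves_TEA_pairs T"
    using assms decoupled_imp_preserves_TEA preserves_TEA_imp_decoupled by blast
  moreover have "decoupled T \<longleftrightarrow> two_trace_form T \<or> diagonal_form T"
    using assms decoupled_imp_form two_trace_form_imp_decoupled diagonal_form_imp_preserves_TEA
      preserves_TEA_imp_decoupled by blast
  moreover have "preserves_parallel_pairs T \<longleftrightarrow> decoupled T \<or> one_trace_form T"
    using assms preserves_parallel_imp_decoupled_or_one_trace one_trace_form_preserves_parallel
      TEA_imp_parallel_preserving decoupled_imp_preserves_TEA by blast
  ultimately show ?thesis
    by blast
qed

end
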